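(* Let $E$ be the directed graph with vertices $1,2,3$ and six edges $a\colon 1\to 2$, $b\colon 3\to 2$, $c\colon 2\to 1$, $d\colon 2\to 1$, $e\colon 2\to 3$, $f\colon 2\to 3$. Let $F$ be the directed graph with vertices $1,2,3$ and six edges $a'\colon 1\to 2$, $b'\colon 3\to 2$, $c'\colon 2\to 1$, $d'\colon 2\to 1$, $e'\colon 2\to 1$, $f'\colon 2\to 3$. Then the one-sided edge shifts $\mathsf{X}_E$ and $\mathsf{X}_F$ are irreducible one-sided shifts of finite type which are eventually conjugate but not (one-sided) conjugate.
   Context: Let $\mathbb{N}=\{0,1,2,\dots\}$. For a finite directed graph $G$, the one-sided edge shift $\mathsf{X}_G$ is the set of infinite sequences $(x_n)_{n\in\mathbb{N}}$ of edges of $G$ such that the terminal vertex of $x_n$ is the initial vertex of $x_{n+1}$ for all $n$, with the subspace topology of the product topology, together with the shift map $\sigma_G\colon\mathsf{X}_G\to\mathsf{X}_G$, $(\sigma_G(x))_n=x_{n+1}$. The edge shift is irreducible if for all finite words $u,w$ occurring in elements of $\mathsf{X}_G$ there is a finite word $v$ such that $uvw$ occurs in some element of $\mathsf{X}_G$. One-sided shifts $(\mathsf{X}_E,\sigma_E)$ and $(\mathsf{X}_F,\sigma_F)$ are conjugate if there is a homeomorphism $h\colon\mathsf{X}_E\to\mathsf{X}_F$ with $h\circ\sigma_E=\sigma_F\circ h$. They are eventually conjugate if there exist a homeomorphism $h\colon\mathsf{X}_E\to\mathsf{X}_F$ and $L\in\mathbb{N}$ such that $\sigma_F^L(h(\sigma_E(x)))=\sigma_F^{L+1}(h(x))$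 and $\sigma_E^L(h^{-1}(\sigma_F(y)))=\sigma_E^{L+1}(h^{-1}(y))$ for all $x\in\mathsf{X}_E$ and $y\in\mathsf{X}_F$. *)

theory Defs
  imports "HOL-Analysis.Abstract_Topology" "HOL-Analysis.Function_Topology" "Graph_Theory.Digraph"
begin

section \<open>One-sided sequences and shifts of finite type\<close>

definition shift_map :: "(nat \<Rightarrow> 'a) \<Rightarrow> nat \<Rightarrow> 'a" where
  "shift_map x = (\<lambda>n. x (Suc n))"

definition occurs_in :: "'a list \<Rightarrow> (nat \<Rightarrow> 'a) \<Rightarrow> bool" where
  "occurs_in w x \<longleftrightarrow> (\<exists>i. \<forall>k < length w. w ! k = x (i + k))"

definition shift_language :: "(nat \<Rightarrow> 'a) set \<Rightarrow> 'a list set" where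
  "shift_language X = {w. \<exists>x \<in> X. occurs_in w x}"

definition irreducible_shift :: "(nat \<Rightarrow> 'a) set \<Rightarrow> bool" where
  "irreducible_shift X \<longleftrightarrow>
     (\<forall>u \<in> shift_language X. \<forall>w \<in> shift_language X. \<exists>v. u @ v @ w \<in> shift_language X)"

definition one_sided_SFT :: "'a set \<Rightarrow> (nat \<Rightarrow> 'a) set \<Rightarrow> bool" where
  "one_sided_SFT A X \<longleftrightarrow> finite A \<and>
     (\<exists>W. finite W \<and> W \<subseteq> lists A \<and>
        X = {x. range x \<subseteq> A \<and> (\<forall>w \<in> W. \<not> occurs_in w x)})"


section \<open>Edge shifts\<close>

definition edge_shift :: "('v, 'e) pre_digraph \<Rightarrow> (nat \<Rightarrow> 'e) set" where
  "edge_shift G =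
     {x. \<forall>n. x n \<in> arcs G \<and> head G (x n) = tail G (x (Suc n))}"

definition edge_shift_topology :: "('v, 'e) pre_digraph \<Rightarrow> (nat \<Rightarrow> 'e) topology" where
  "edge_shift_topology G =
     subtopology (product_topology (\<lambda>_. discrete_topology (arcs G)) UNIV) (edge_shift G)"

lemma topspace_edge_shift_topology: "topspace (edge_shift_topology G) = edge_shift G"
  by (auto simp: edge_shift_topology_def edge_shift_def)

definition one_sided_conjugate ::
    "('v, 'e) pre_digraph \<Rightarrow> ('w, 'f) pre_digraph \<Rightarrow> bool" where
  "one_sided_conjugate G H \<longleftrightarrow>
     (\<exists>h. homeomorphic_map (edge_shift_topology G) (edge_shift_topology H) h \<and>
          (\<forall>x \<in> edge_shift G. h (shift_map x) = shift_map (h x)))"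

text \<open>In the following definition \<open>g\<close> is the inverse of the homeomorphism \<open>h\<close>.\<close>

definition eventually_conjugate ::
    "('v, 'e) pre_digraph \<Rightarrow> ('w, 'f) pre_digraph \<Rightarrow> bool" where
  "eventually_conjugate G H \<longleftrightarrow>
     (\<exists>h g L. homeomorphic_maps (edge_shift_topology G) (edge_shift_topology H) h g \<and>
        (\<forall>x \<in> edge_shift G.
           (shift_map ^^ L) (h (shift_map x)) = (shift_map ^^ (L + 1)) (h x)) \<and>
        (\<forall>y \<in> edge_shift H.
           (shift_map ^^ L) (g (shift_map y)) = (shift_map ^^ (L + 1)) (g y)))"


section \<open>The two graphs\<close>

datatype edge_E = aE | bE | cE | dE | eE | fE
datatype edge_F = aF | bF | cF | dF | eF | fF

fun tail_E :: "edge_E \<Rightarrow> nat" where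
  "tail_E aE = 1" | "tail_E bE = 3" | "tail_E cE = 2"
| "tail_E dE = 2" | "tail_E eE = 2" | "tail_E fE = 2"

fun head_E :: "edge_E \<Rightarrow> nat" where
  "head_E aE = 2" | "head_E bE = 2" | "head_E cE = 1"
| "head_E dE = 1" | "head_E eE = 3" | "head_E fE = 3"

fun tail_F :: "edge_F \<Rightarrow> nat" where
  "tail_F aF = 1" | "tail_F bF = 3" | "tail_F cF = 2"
| "tail_F dF = 2" | "tail_F eF = 2" | "tail_F fF = 2"

fun head_F :: "edge_F \<Rightarrow> nat" where
  "head_F aF = 2" | "head_F bF = 2" | "head_F cF = 1"
| "head_F dF = 1" | "head_F eF = 1" | "head_F fF = 3"

definition graph_E :: "(nat, edge_E) pre_digraph" where
  "graph_E = \<lparr>verts = {1, 2, 3}, arcs = {aE, bE, cE, dE, eE, fE}, tail = tail_E, head = head_E\<rparr>"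

definition graph_F :: "(nat, edge_F) pre_digraph" where
  "graph_F = \<lparr>verts = {1, 2, 3}, arcs = {aF, bF, cF, dF, eF, fF}, tail = tail_F, head = head_F\<rparr>"

lemma fin_digraph_graph_E: "fin_digraph graph_E"
  by unfold_locales (auto simp: graph_E_def)

lemma fin_digraph_graph_F: "fin_digraph graph_F"
  by unfold_locales (auto simp: graph_F_def)

end

theory Submission
  imports Defs "HOL-Analysis.Product_Topology"
begin

text \<open>
  Both graphs describe a vertex \<open>2\<close> with four loops of length two through the vertices \<open>1\<close> and
  \<open>3\<close>: in \<open>E\<close> two of the loops pass through each of the two vertices, in \<open>F\<close> three pass through \<open>1\<close>
  and one passes through \<open>3\<close>.

  The shifts are eventually conjugate because a path is, up to an initial edge that may enter \<open>2\<close>, a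
  free sequence of such loops, and there are four loops in either graph. Translate an initial \<open>a\<close>
  or \<open>b\<close> by its primed counterpart, and every loop, named by its edge leaving \<open>2\<close>, by the loop with the
  primed name. Only the loop of \<open>e\<close> changes its intermediate vertex, so an edge entering \<open>2\<close> has to be
  translated according to the edge before it (\<open>code_EF\<close>, \<open>code_FE\<close>). The initial edge has
  no predecessor and is translated by a rule of its own, and hence the map fails to commute
  with the shift, but only in the very first coordinate (\<open>shift_start_code\<close>), which one further shift
  deletes.

  They are not conjugate because a conjugacy preserves the number of preimages of a point under the
  shift, which for an edge shift is the number of edges entering the initial vertex. Every
  vertex of \<open>E\<close> has two incoming edges, while the vertex \<open>3\<close> of \<open>F\<close> has only one.
\<close>

section \<open>Edge shifts are shifts of finite type\<close>

lemma edge_shiftD: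
  assumes "x \<in> edge_shift G"
  shows "x n \<in> arcs G" "head G (x n) = tail G (x (Suc n))"
  using assms by (auto simp: edge_shift_def)

lemma occurs_in_pair: "occurs_in [u, v] x \<longleftrightarrow> (\<exists>i. x i = u \<and> x (Suc i) = v)"
  by (auto simp: occurs_in_def All_less_Suc2)

text \<open>Being a path is a condition on pairs of consecutive edges, so it suffices to forbid the
  finitely many words of length two that are not paths.\<close>

lemma one_sided_SFT_edge_shift:
  assumes "finite (arcs G)"
  shows "one_sided_SFT (arcs G) (edge_shift G)"
proof -
  define W where "W = (\<lambda>(u, v). [u, v]) ` {(u, v) \<in> arcs G \<times> arcs G. head G u \<noteq> tail G v}"
  have "finite W"
    unfolding W_def using assms by (intro finite_imageI finite_subset[OF _ finite_cartesian_product]) auto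
  moreover have "W \<subseteq> lists (arcs G)"
    by (auto simp: W_def)
  moreover have "edge_shift G = {x. range x \<subseteq> arcs G \<and> (\<forall>w \<in> W. \<not> occurs_in w x)}"
    by (fastforce simp: edge_shift_def W_def occurs_in_pair)
  ultimately show ?thesis
    using assms unfolding one_sided_SFT_def by blast
qed

section \<open>Irreducibility\<close>

definition glue :: "nat \<Rightarrow> (nat \<Rightarrow> 'a) \<Rightarrow> (nat \<Rightarrow> 'a) \<Rightarrow> nat \<Rightarrow> 'a" where
  "glue k x y = (\<lambda>n. if n < k then x n else y (n - k))"

lemma glue_in_edge_shift:
  assumes "x \<in> edge_shift G" "y \<in> edge_shift G" "k > 0" "head G (x (k - 1)) = tail G (y 0)"
  shows "glue k x y \<in> edge_shift G"
proof -
  have "head G (glue k x y n) = tail G (glue k x y (Suc n))" for n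
  proof -
    consider "Suc n < k" | "Suc n = k" | "n \<ge> k" by linarith
    then show ?thesis
      using assms by cases (auto simp: glue_def edge_shiftD Suc_diff_le)
  qed
  moreover have "glue k x y n \<in> arcs G" for n
    using assms by (auto simp: glue_def edge_shiftD)
  ultimately show ?thesis
    by (simp add: edge_shift_def)
qed

lemma edge_shift_suffix:
  assumes "x \<in> edge_shift G"
  shows "(\<lambda>n. x (i + n)) \<in> edge_shift G"
  using assms by (simp add: edge_shift_def)

lemma shift_languageE:
  assumes "w \<in> shift_language (edge_shift G)"
  obtains x where "x \<in> edge_shift G" "\<forall>k < length w. x k = w ! k"
proof -
  obtain y i where "y \<in> edge_shift G" "\<forall>k < length w. w ! k = y (i + k)"
    using assms by (auto simp: shift_language_def occurs_in_def)
  then show thesis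
    using that[of "\<lambda>n. y (i + n)"] edge_shift_suffix by metis
qed

text \<open>The path \<open>z\<close> supplies a segment connecting any two words: follow the first word, then that
  segment, then the second word.\<close>

lemma irreducible_edge_shift:
  assumes z: "z \<in> edge_shift G"
    and visits: "\<And>e f. e \<in> arcs G \<Longrightarrow> f \<in> arcs G \<Longrightarrow>
      \<exists>i k. tail G (z i) = head G e \<and> head G (z (i + k)) = tail G f"
  shows "irreducible_shift (edge_shift G)"
  unfolding irreducible_shift_def
proof (intro ballI)
  fix u w
  assume u: "u \<in> shift_language (edge_shift G)" and w: "w \<in> shift_language (edge_shift G)"
  show "\<exists>v. u @ v @ w \<in> shift_language (edge_shift G)"
  proof (cases "u = []")
    case True
    then show ?thesis
      using w by (auto intro: exI[of _ "[]"])
  next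
    case False
    obtain x where x: "x \<in> edge_shift G" "\<forall>k < length u. x k = u ! k"
      using u by (rule shift_languageE)
    obtain y where y: "y \<in> edge_shift G" "\<forall>k < length w. y k = w ! k"
      using w by (rule shift_languageE)
    obtain i k where ik: "tail G (z i) = head G (x (length u - 1))" "head G (z (i + k)) = tail G (y 0)"
      using visits edge_shiftD(1) x(1) y(1) by metis
    define s where "s = glue (length u) x (glue (Suc k) (\<lambda>n. z (i + n)) y)"
    define v where "v = map (\<lambda>n. z (i + n)) [0..<Suc k]"
    have "s \<in> edge_shift G"
      unfolding s_def using x(1) y(1) z ik False
      by (intro glue_in_edge_shift edge_shift_suffix) (auto simp: glue_def)
    moreover have "(u @ v @ w) ! n = s (0 + n)" if "n < length (u @ v @ w)" for n
      using that by (auto simp: s_def v_def glue_def nth_append x y simp del: upt_Suc)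
    ultimately show ?thesis
      unfolding shift_language_def occurs_in_def by blast
  qed
qed

text \<open>The periodic path used below meets the vertices \<open>2, 1, 2, 3\<close> in turn. It leaves the vertices
  \<open>2\<close>, \<open>1\<close>, \<open>3\<close> at the times \<open>0\<close>, \<open>1\<close>, \<open>3\<close>, and reaches \<open>1\<close>, \<open>2\<close>, \<open>3\<close> by its edges number
  \<open>4\<close>, \<open>5\<close>, \<open>6\<close>, that is, after all these departures.\<close>

lemma irreducible_by_tour:
  assumes arcs: "{p, q, r, s} \<subseteq> arcs G"
    and "tail G p = (2::nat)" "head G p = 1" "tail G q = 1" "head G q = 2"
    and "tail G r = 2" "head G r = 3" "tail G s = 3" "head G s = 2"
    and ends: "\<And>e. e \<in> arcs G \<Longrightarrow> tail G e \<in> {1, 2, 3} \<and> head G e \<in> {1, 2, 3}"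
  shows "irreducible_shift (edge_shift G)"
proof (rule irreducible_edge_shift)
  define z where "z = (\<lambda>n::nat. [p, q, r, s] ! (n mod 4))"
  show "z \<in> edge_shift G"
  proof -
    have "z n \<in> arcs G \<and> head G (z n) = tail G (z (Suc n))" for n
    proof -
      consider "n mod 4 = 0" | "n mod 4 = 1" | "n mod 4 = 2" | "n mod 4 = 3" by linarith
      then show ?thesis
        using assms(1-9) by cases (simp_all add: z_def mod_Suc)
    qed
    then show ?thesis
      by (simp add: edge_shift_def)
  qed
  fix e f
  assume ef: "e \<in> arcs G" "f \<in> arcs G"
  have "\<exists>i \<le> 3. tail G (z i) = head G e"
  proof -
    have "tail G (z 0) = 2" "tail G (z 1) = 1" "tail G (z 3) = 3"
      using assms(2-9) by (simp_all add: z_def)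
    moreover have "(0::nat) \<le> 3" "(1::nat) \<le> 3" "(3::nat) \<le> 3" by auto
    ultimately show ?thesis
      using ends[OF ef(1)] by (metis insertE singletonD)
  qed
  moreover have "\<exists>j \<ge> 3. head G (z j) = tail G f"
  proof -
    have "head G (z 4) = 1" "head G (z 5) = 2" "head G (z 6) = 3"
      using assms(2-9) by (simp_all add: z_def)
    moreover have "(3::nat) \<le> 4" "(3::nat) \<le> 5" "(3::nat) \<le> 6" by auto
    ultimately show ?thesis
      using ends[OF ef(2)] by (metis insertE singletonD)
  qed
  ultimately obtain i j where "i \<le> 3" "3 \<le> j" "tail G (z i) = head G e" "head G (z j) = tail G f"
    by blast
  then show "\<exists>i k. tail G (z i) = head G e \<and> head G (z (i + k)) = tail G f"
    by (metis le_add_diff_inverse order.trans)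
qed

lemma arcs_graph_E: "arcs graph_E = UNIV"
proof -
  have "e \<in> arcs graph_E" for e
    by (cases e) (simp_all add: graph_E_def)
  then show ?thesis by blast
qed

lemma arcs_graph_F: "arcs graph_F = UNIV"
proof -
  have "e \<in> arcs graph_F" for e
    by (cases e) (simp_all add: graph_F_def)
  then show ?thesis by blast
qed

lemma tail_head_graph [simp]:
  "tail graph_E = tail_E" "head graph_E = head_E" "tail graph_F = tail_F" "head graph_F = head_F"
  by (auto simp: graph_E_def graph_F_def)

lemma irreducible_edge_shift_E: "irreducible_shift (edge_shift graph_E)"
proof (rule irreducible_by_tour[of cE aE eE bE])
  show "tail graph_E e \<in> {1, 2, 3} \<and> head graph_E e \<in> {1, 2, 3}" for e
    by (cases e) auto
qed (auto simp: arcs_graph_E)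

lemma irreducible_edge_shift_F: "irreducible_shift (edge_shift graph_F)"
proof (rule irreducible_by_tour[of cF aF fF bF])
  show "tail graph_F e \<in> {1, 2, 3} \<and> head graph_F e \<in> {1, 2, 3}" for e
    by (cases e) auto
qed (auto simp: arcs_graph_F)

section \<open>Codes with a special rule for the first letter\<close>

definition start_code :: "('a \<Rightarrow> 'b) \<Rightarrow> ('a \<Rightarrow> 'a \<Rightarrow> 'b) \<Rightarrow> (nat \<Rightarrow> 'a) \<Rightarrow> nat \<Rightarrow> 'b" where
  "start_code r q x = (\<lambda>n. case n of 0 \<Rightarrow> r (x 0) | Suc m \<Rightarrow> q (x m) (x (Suc m)))"

lemma start_code_simps [simp]:
  "start_code r q x 0 = r (x 0)"
  "start_code r q x (Suc m) = q (x m) (x (Suc m))"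
  by (simp_all add: start_code_def)

text \<open>All coordinates but the first are produced by one rule that ignores the position.\<close>

lemma shift_start_code:
  "(shift_map ^^ 1) (start_code r q (shift_map x)) = (shift_map ^^ (1 + 1)) (start_code r q x)"
  by (simp add: shift_map_def)

lemma continuous_map_start_code:
  fixes G :: "('v, 'a) pre_digraph" and H :: "('w, 'b) pre_digraph"
  assumes maps: "\<And>x. x \<in> edge_shift G \<Longrightarrow> start_code r q x \<in> edge_shift H"
  shows "continuous_map (edge_shift_topology G) (edge_shift_topology H) (start_code r q)"
proof -
  let ?T = "edge_shift_topology G"
  have coord: "continuous_map ?T (discrete_topology (arcs G)) (\<lambda>x. x n)" for n
    unfolding edge_shift_topology_def
    by (intro continuous_map_from_subtopology continuous_map_product_projection) auto
  \<comment> \<open>A pair of coordinates varies in a discrete space, on which every map is continuous.\<close>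
  have pair: "continuous_map ?T (discrete_topology (arcs G \<times> arcs G)) (\<lambda>x. (x m, x n))" for m n
    using continuous_map_pairedI[OF coord coord] by (simp only: prod_topology_discrete_topology)
  have into: "start_code r q x n \<in> arcs H" if "x \<in> topspace ?T" for x n
    using that maps edge_shiftD(1) by (metis topspace_edge_shift_topology)
  have "continuous_map ?T (discrete_topology (arcs H)) (\<lambda>x. start_code r q x n)" for n
  proof -
    have "\<exists>f m k. \<forall>x. start_code r q x n = f (x m, x k)"
    proof (cases n)
      case 0
      then show ?thesis by (intro exI[of _ "\<lambda>p. r (fst p)"] exI[of _ 0]) simp
    next
      case (Suc m)
      then show ?thesis by (intro exI[of _ "case_prod q"] exI[of _ m] exI[of _ "Suc m"]) simp
    qed
    then obtain f m k where f: "\<And>x. start_code r q x n = f (x m, x k)" by blast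
    have "continuous_map ?T (discrete_topology UNIV) (f \<circ> (\<lambda>x. (x m, x k)))"
      using pair by (rule continuous_map_compose) simp
    then have "continuous_map ?T (discrete_topology UNIV) (\<lambda>x. start_code r q x n)"
      by (simp add: f comp_def)
    then have "continuous_map ?T (subtopology (discrete_topology UNIV) (arcs H)) (\<lambda>x. start_code r q x n)"
      by (rule continuous_map_into_subtopology) (use into in blast)
    then show ?thesis
      by (simp add: subtopology_discrete_topology)
  qed
  then show ?thesis
    using maps topspace_edge_shift_topology[of G]
    by (auto simp: edge_shift_topology_def[of H] continuous_map_in_subtopology
        continuous_map_componentwise_UNIV)
qed

text \<open>Such codes are continuous and respect the shift up to the first coordinate, so only
  bijectivity remains to be checked.\<close>

lemma eventually_conjugate_by_start_codes:
  assumes "\<And>x. x \<in> edge_shift G \<Longrightarrow> start_code r q x \<in> edge_shift H"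
    and "\<And>y. y \<in> edge_shift H \<Longrightarrow> start_code r' q' y \<in> edge_shift G"
    and "\<And>x. x \<in> edge_shift G \<Longrightarrow> start_code r' q' (start_code r q x) = x"
    and "\<And>y. y \<in> edge_shift H \<Longrightarrow> start_code r q (start_code r' q' y) = y"
  shows "eventually_conjugate G H"
  unfolding eventually_conjugate_def
proof (intro exI conjI ballI)
  show "homeomorphic_maps (edge_shift_topology G) (edge_shift_topology H)
      (start_code r q) (start_code r' q')"
    using assms unfolding homeomorphic_maps_def topspace_edge_shift_topology
    by (auto intro!: continuous_map_start_code)
qed (rule shift_start_code)+

section \<open>The eventual conjugacy\<close>

fun prime_edge :: "edge_E \<Rightarrow> edge_F" where
  "prime_edge aE = aF" | "prime_edge bE = bF" | "prime_edge cE = cF"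
| "prime_edge dE = dF" | "prime_edge eE = eF" | "prime_edge fE = fF"

fun unprime_edge :: "edge_F \<Rightarrow> edge_E" where
  "unprime_edge aF = aE" | "unprime_edge bF = bE" | "unprime_edge cF = cE"
| "unprime_edge dF = dE" | "unprime_edge eF = eE" | "unprime_edge fF = fE"

text \<open>The first argument is the preceding edge: the return to the vertex \<open>2\<close> has to start where the
  translation of that edge ends.\<close>

definition code_EF :: "edge_E \<Rightarrow> edge_E \<Rightarrow> edge_F" where
  "code_EF p e = (if e \<in> {aE, bE} then if p = fE then bF else aF else prime_edge e)"

definition code_FE :: "edge_F \<Rightarrow> edge_F \<Rightarrow> edge_E" where
  "code_FE p e = (if e \<in> {aF, bF} then if p \<in> {cF, dF} then aE else bE else unprime_edge e)"

lemma code_EF_path: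
  assumes "head_E e = tail_E e'"
  shows "head_F (prime_edge e) = tail_F (code_EF e e')" "head_F (code_EF p e) = tail_F (code_EF e e')"
  using assms by (cases e; cases e'; simp add: code_EF_def)+

lemma start_code_EF_in_edge_shift:
  assumes "x \<in> edge_shift graph_E"
  shows "start_code prime_edge code_EF x \<in> edge_shift graph_F"
proof -
  have "head_E (x n) = tail_E (x (Suc n))" for n
    using edge_shiftD(2)[OF assms] by simp
  then have "head_F (start_code prime_edge code_EF x n) = tail_F (start_code prime_edge code_EF x (Suc n))" for n
    by (cases n) (simp_all add: code_EF_path)
  then show ?thesis
    by (simp add: edge_shift_def arcs_graph_F)
qed

lemma code_FE_path:
  assumes "head_F e = tail_F e'"
  shows "head_E (unprime_edge e) = tail_E (code_FE e e')" "head_E (code_FE p e) = tail_E (code_FE e e')"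
  using assms by (cases e; cases e'; simp add: code_FE_def)+

lemma start_code_FE_in_edge_shift:
  assumes "y \<in> edge_shift graph_F"
  shows "start_code unprime_edge code_FE y \<in> edge_shift graph_E"
proof -
  have "head_F (y n) = tail_F (y (Suc n))" for n
    using edge_shiftD(2)[OF assms] by simp
  then have "head_E (start_code unprime_edge code_FE y n) = tail_E (start_code unprime_edge code_FE y (Suc n))" for n
    by (cases n) (simp_all add: code_FE_path)
  then show ?thesis
    by (simp add: edge_shift_def arcs_graph_E)
qed

text \<open>The two codes undo each other because the predecessor of an edge entering \<open>2\<close> leaves \<open>2\<close>
  and is therefore merely renamed, also when it is the first edge; it then determines whether the
  original edge was \<open>a\<close> or \<open>b\<close>.\<close>

lemma start_code_FE_EF:
  assumes "x \<in> edge_shift graph_E"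
  shows "start_code unprime_edge code_FE (start_code prime_edge code_EF x) = x"
proof
  have renamed: "start_code prime_edge code_EF x n = prime_edge (x n)" if "x n \<notin> {aE, bE}" for n
    using that by (cases n) (auto simp: code_EF_def)
  show "start_code unprime_edge code_FE (start_code prime_edge code_EF x) n = x n" for n
  proof (cases n)
    case 0
    then show ?thesis by (cases "x 0") auto
  next
    case (Suc m)
    then show ?thesis
      using edge_shiftD(2)[OF assms, of m] renamed[of m]
      by (cases "x m"; cases "x (Suc m)") (auto simp: code_FE_def code_EF_def)
  qed
qed

lemma start_code_EF_FE:
  assumes "y \<in> edge_shift graph_F"
  shows "start_code prime_edge code_EF (start_code unprime_edge code_FE y) = y"
proof
  have renamed: "start_code unprime_edge code_FE y n = unprime_edge (y n)" if "y n \<notin> {aF, bF}" for n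
    using that by (cases n) (auto simp: code_FE_def)
  show "start_code prime_edge code_EF (start_code unprime_edge code_FE y) n = y n" for n
  proof (cases n)
    case 0
    then show ?thesis by (cases "y 0") auto
  next
    case (Suc m)
    then show ?thesis
      using edge_shiftD(2)[OF assms, of m] renamed[of m]
      by (cases "y m"; cases "y (Suc m)") (auto simp: code_FE_def code_EF_def)
  qed
qed

lemma eventually_conjugate_E_F: "eventually_conjugate graph_E graph_F"
  by (rule eventually_conjugate_by_start_codes[OF start_code_EF_in_edge_shift
      start_code_FE_in_edge_shift start_code_FE_EF start_code_EF_FE])

section \<open>Preimages under the shift\<close>

lemma shift_map_case_nat [simp]: "shift_map (case_nat e x) = x"
  by (simp add: shift_map_def)

lemma case_nat_in_edge_shift:
  assumes "x \<in> edge_shift G" "e \<in> arcs G" "head G e = tail G (x 0)"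
  shows "case_nat e x \<in> edge_shift G"
  using assms by (auto simp: edge_shift_def split: nat.split)

text \<open>The preimages of a point correspond to the edges entering its initial vertex, and a
  conjugacy preserves their number.\<close>

lemma not_one_sided_conjugate_by_indegree:
  assumes two: "\<And>v. v \<in> tail G ` arcs G \<Longrightarrow>
      \<exists>e \<in> arcs G. \<exists>e' \<in> arcs G. e \<noteq> e' \<and> head G e = v \<and> head G e' = v"
    and y: "y \<in> edge_shift H"
    and one: "\<And>e e'. e \<in> arcs H \<Longrightarrow> e' \<in> arcs H \<Longrightarrow>
      head H e = tail H (y 0) \<Longrightarrow> head H e' = tail H (y 0) \<Longrightarrow> e = e'"
  shows "\<not> one_sided_conjugate G H"
proof
  assume "one_sided_conjugate G H"
  then obtain h where homeo: "homeomorphic_map (edge_shift_topology G) (edge_shift_topology H) h"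
    and comm: "\<And>x. x \<in> edge_shift G \<Longrightarrow> h (shift_map x) = shift_map (h x)"
    unfolding one_sided_conjugate_def by blast
  have bij: "bij_betw h (edge_shift G) (edge_shift H)"
    using homeo homeomorphic_imp_surjective_map homeomorphic_imp_injective_map
    by (metis bij_betw_def topspace_edge_shift_topology)
  obtain x where x: "x \<in> edge_shift G" "h x = y"
    using bij y by (metis bij_betw_imp_surj_on imageE)
  obtain e e' where e: "e \<in> arcs G" "e' \<in> arcs G" "e \<noteq> e'" "head G e = tail G (x 0)" "head G e' = tail G (x 0)"
    using two[of "tail G (x 0)"] edge_shiftD(1)[OF x(1)] by blast
  have pre: "h (case_nat d x) \<in> edge_shift H" "shift_map (h (case_nat d x)) = y"
    if "d \<in> arcs G" "head G d = tail G (x 0)" for d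
    using case_nat_in_edge_shift[OF x(1) that] bij comm[of "case_nat d x"] x(2)
    by (auto simp: bij_betw_def)
  have unique: "w = w'"
    if "w \<in> edge_shift H" "shift_map w = y" "w' \<in> edge_shift H" "shift_map w' = y" for w w'
  proof
    have later: "w (Suc n) = y n" "w' (Suc n) = y n" for n
      using that(2,4) unfolding shift_map_def by (blast dest: fun_cong)+
    have "w 0 = w' 0"
      using one edge_shiftD[OF that(1), of 0] edge_shiftD[OF that(3), of 0] later by metis
    then show "w n = w' n" for n
      using later by (cases n) auto
  qed
  have "h (case_nat e x) = h (case_nat e' x)"
    using unique pre e by blast
  then have "case_nat e x = case_nat e' x"
    using bij case_nat_in_edge_shift[OF x(1)] e by (meson bij_betw_def inj_onD)
  then have "case_nat e x 0 = case_nat e' x 0" by simp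
  then show False using e(3) by simp
qed

lemma not_one_sided_conjugate_E_F: "\<not> one_sided_conjugate graph_E graph_F"
proof (rule not_one_sided_conjugate_by_indegree)
  fix v
  assume "v \<in> tail graph_E ` arcs graph_E"
  then obtain d where v: "v = tail_E d" by auto
  have "head_E aE = 2" "head_E bE = 2" "head_E cE = 1" "head_E dE = 1" "head_E eE = 3" "head_E fE = 3"
    by simp_all
  then show "\<exists>e \<in> arcs graph_E. \<exists>e' \<in> arcs graph_E. e \<noteq> e' \<and> head graph_E e = v \<and> head graph_E e' = v"
    unfolding v arcs_graph_E by (cases d) (force simp del: head_E.simps)+
next
  show "(\<lambda>n. if even n then bF else fF) \<in> edge_shift graph_F"
    by (auto simp: edge_shift_def arcs_graph_F)
next
  fix e e'
  assume "head graph_F e = tail graph_F ((\<lambda>n. if even n then bF else fF) (0::nat))"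
    "head graph_F e' = tail graph_F ((\<lambda>n. if even n then bF else fF) (0::nat))"
  then show "e = e'"
    by (cases e; cases e') auto
qed

section \<open>The two edge shifts\<close>

theorem mainTheorem3:
  "one_sided_SFT (arcs graph_E) (edge_shift graph_E) \<and>
   irreducible_shift (edge_shift graph_E) \<and>
   one_sided_SFT (arcs graph_F) (edge_shift graph_F) \<and>
   irreducible_shift (edge_shift graph_F) \<and>
   eventually_conjugate graph_E graph_F \<and>
   \<not> one_sided_conjugate graph_E graph_F"
  by (intro conjI one_sided_SFT_edge_shift fin_digraph.finite_arcs fin_digraph_graph_E fin_digraph_graph_F
      irreducible_edge_shift_E irreducible_edge_shift_F eventually_conjugate_E_F not_one_sided_conjugate_E_F)

end
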